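(* Let $\Omega$ be a bounded domain of $\mathbb{R}^N$, and let $L=L(x,u,z)\in \mathrm{C}^2(\Omega\times\mathbb{R}\times\mathbb{R}^N)\cap \mathrm{C}^1(\overline\Omega\times\mathbb{R}\times\mathbb{R}^N)$ be a real-valued Lagrangian satisfying, for all $x\in\Omega$ and $u\in\mathbb{R}$, $$\sum_{i=1}^N L_{x_iz_i}(x,u,0)=0\qquad\text{and}\qquad L_{x_iu}(x,u,0)=0\ \text{ for all } i=1,\dots,N,$$ and such that $L_u(x,u,z)\neq 0$ for all $(x,u,z)\in\Omega\times\mathbb{R}\times\mathbb{R}^N$. Then for every real-valued solution $u\in \mathrm{C}^2(\Omega)\cap \mathrm{C}^1(\overline\Omega)$ of the partial differential equation $$\sum_{j=1}^N\frac{\partial}{\partial x_j}\big[L_{z_j}(x,u(x),Du(x))\big]-L_u(x,u(x),Du(x))=0\quad\text{in }\Omega,$$ the set $\mathrm{A}_0:=\{x\in\Omega:\ Du(x)=0\}$ has no interior point.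
   Context: A domain is an open connected subset of $\mathbb{R}^N$. $\mathrm{C}^1(\overline\Omega)$ denotes the set of restrictions to $\Omega$ of continuously differentiable functions on $\mathbb{R}^N$, and similarly $\mathrm{C}^1(\overline\Omega\times\mathbb{R}\times\mathbb{R}^N)$. Subscripts on $L$ denote partial derivatives with respect to the independent variables $x\in\Omega$, $u\in\mathbb{R}$, $z\in\mathbb{R}^N$ ($z$ is the slot for $Du$); $\frac{\partial}{\partial x_j}[\cdots]$ denotes the derivative of the composed function of $x$. *)

theory Defs
  imports "HOL-Analysis.Analysis"
begin

(* Derivative of f at x along the coordinate line through x in direction b,
   where b is a basis vector. As with deriv, it is unspecified if this derivative does not exist. *)
definition partial_deriv ::
  "'a \<Rightarrow> ('a::real_normed_vector \<Rightarrow> real) \<Rightarrow> 'a \<Rightarrow> real" where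
  "partial_deriv b f x = deriv (\<lambda>t. f (x + t *\<^sub>R b)) 0"

(* Only meaningful for open S, where differentiable_on is differentiability at every point of S. *)
primrec Ck_on :: "nat \<Rightarrow> 'a::euclidean_space set \<Rightarrow> ('a \<Rightarrow> real) \<Rightarrow> bool" where
  "Ck_on 0 S f \<longleftrightarrow> continuous_on S f"
| "Ck_on (Suc k) S f \<longleftrightarrow> f differentiable_on S \<and> (\<forall>b\<in>Basis. Ck_on k S (partial_deriv b f))"

(* For open S, the class C^1 of the closure of S: restrictions to S of C^1 functions on the whole
   space. Values of f outside S are irrelevant. *)
definition C1_closure_on :: "'a::euclidean_space set \<Rightarrow> ('a \<Rightarrow> real) \<Rightarrow> bool" where
  "C1_closure_on S f \<longleftrightarrow> (\<exists>g. Ck_on 1 UNIV g \<and> (\<forall>x\<in>S. f x = g x))"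

definition gradient :: "(real ^ 'n \<Rightarrow> real) \<Rightarrow> real ^ 'n \<Rightarrow> real ^ 'n" where
  "gradient f x = (\<chi> i. partial_deriv (axis i 1) f x)"

definition deriv_x ::
  "'n \<Rightarrow> ((real ^ 'n) \<times> real \<times> (real ^ 'n) \<Rightarrow> real) \<Rightarrow> (real ^ 'n) \<times> real \<times> (real ^ 'n) \<Rightarrow> real" where
  "deriv_x i L = partial_deriv (axis i 1, 0, 0) L"

definition deriv_u ::
  "((real ^ 'n) \<times> real \<times> (real ^ 'n) \<Rightarrow> real) \<Rightarrow> (real ^ 'n) \<times> real \<times> (real ^ 'n) \<Rightarrow> real" where
  "deriv_u L = partial_deriv (0, 1, 0) L"

definition deriv_z ::
  "'n \<Rightarrow> ((real ^ 'n) \<times> real \<times> (real ^ 'n) \<Rightarrow> real) \<Rightarrow> (real ^ 'n) \<times> real \<times> (real ^ 'n) \<Rightarrow> real" where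
  "deriv_z i L = partial_deriv (0, 0, axis i 1) L"

end

theory Submission
  imports Defs
begin

text \<open>On an open subset of \<open>A\<^sub>0\<close> the solution is locally a constant \<open>c\<close>, so there the equation
  reads \<open>\<Sum>\<^sub>j L\<^sub>z\<^sub>j\<^sub>x\<^sub>j (x, c, 0) = L\<^sub>u (x, c, 0)\<close>. By Schwarz's theorem the left-hand side is
  \<open>\<Sum>\<^sub>j L\<^sub>x\<^sub>j\<^sub>z\<^sub>j (x, c, 0) = 0\<close>, contradicting \<open>L\<^sub>u \<noteq> 0\<close>.\<close>

lemma has_derivative_along_line:
  assumes "(f has_derivative D) (at (x + s *\<^sub>R b))"
  shows "((\<lambda>t. f (x + t *\<^sub>R b)) has_real_derivative D b) (at s)"
proof -
  have "((\<lambda>t. f (x + t *\<^sub>R b)) has_derivative (\<lambda>t. D (t *\<^sub>R b))) (at s)"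
    by (rule has_derivative_compose[where g = f])
      (use assms in \<open>auto intro!: derivative_eq_intros\<close>)
  moreover have "(\<lambda>t. D (t *\<^sub>R b)) = (\<lambda>t. D b * t)"
    using linear_scale[OF has_derivative_linear[OF assms]] by (simp add: fun_eq_iff)
  ultimately show ?thesis
    by (simp add: has_field_derivative_def)
qed

lemma has_derivative_partial_deriv:
  assumes "(f has_derivative D) (at x)"
  shows "D b = partial_deriv b f x"
  using has_derivative_along_line[of f D x 0 b] assms
  by (simp add: partial_deriv_def DERIV_imp_deriv)

text \<open>\<open>partial_deriv\<close> is a derivative at parameter \<open>0\<close>. Rebasing the
  line at \<open>x + s *\<^sub>R b\<close> gives the derivative at every parameter \<open>s\<close>,
  as the mean value theorem requires.\<close>

lemma DERIV_along_line:
  assumes "f differentiable at (x + s *\<^sub>R b)"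
  shows "((\<lambda>t. f (x + t *\<^sub>R b)) has_real_derivative partial_deriv b f (x + s *\<^sub>R b)) (at s)"
  using assms has_derivative_along_line has_derivative_partial_deriv
  unfolding differentiable_def by metis

text \<open>Two applications of the mean value theorem, first along \<open>a\<close> and then along
  \<open>b\<close>, turn the second difference into a mixed derivative. The left-hand side is
  symmetric in \<open>a\<close> and \<open>b\<close>, which is what makes mixed derivatives
  comparable.\<close>

lemma second_difference_mean_value:
  assumes f: "\<And>y. y \<in> ball x r \<Longrightarrow> f differentiable at y"
    and fa: "\<And>y. y \<in> ball x r \<Longrightarrow> partial_deriv a f differentiable at y"
    and h: "0 < h" "h * (norm a + norm b) < r"
  shows "\<exists>y\<in>ball x r. f (x + h *\<^sub>R a + h *\<^sub>R b) - f (x + h *\<^sub>R a) - f (x + h *\<^sub>R b) + f x =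
    h\<^sup>2 * partial_deriv b (partial_deriv a f) y"
proof -
  \<comment> \<open>The whole parallelogram with sides \<open>h *\<^sub>R a\<close> and
    \<open>h *\<^sub>R b\<close> stays in the ball, so all intermediate points are
    admissible.\<close>
  have ball: "x + s *\<^sub>R a + t *\<^sub>R b \<in> ball x r" if "0 \<le> s" "s \<le> h" "0 \<le> t" "t \<le> h" for s t
  proof -
    have "norm (s *\<^sub>R a + t *\<^sub>R b) \<le> s * norm a + t * norm b"
      using norm_triangle_ineq[of "s *\<^sub>R a" "t *\<^sub>R b"] that by simp
    also have "\<dots> \<le> h * norm a + h * norm b"
      using that by (intro add_mono mult_right_mono) auto
    finally show ?thesis
      using h by (simp add: dist_norm norm_minus_commute algebra_simps)
  qed
  \<comment> \<open>The increment of \<open>f\<close> along \<open>b\<close>, as a function of the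
    displacement along \<open>a\<close>; the second difference is
    \<open>\<phi> h - \<phi> 0\<close>.\<close>
  define \<phi> where "\<phi> s = f ((x + h *\<^sub>R b) + s *\<^sub>R a) - f (x + s *\<^sub>R a)" for s
  have "\<exists>s. 0 < s \<and> s < h \<and> \<phi> h - \<phi> 0 = (h - 0) *
      (partial_deriv a f ((x + h *\<^sub>R b) + s *\<^sub>R a) - partial_deriv a f (x + s *\<^sub>R a))"
  proof (rule MVT2)
    fix s assume s: "0 \<le> s" "s \<le> h"
    have "(x + h *\<^sub>R b) + s *\<^sub>R a \<in> ball x r" "x + s *\<^sub>R a \<in> ball x r"
      using ball[of s h] ball[of s 0] s h by (simp_all add: algebra_simps)
    then show "(\<phi> has_real_derivative
      partial_deriv a f ((x + h *\<^sub>R b) + s *\<^sub>R a) - partial_deriv a f (x + s *\<^sub>R a)) (at s)"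
      unfolding \<phi>_def by (intro DERIV_diff DERIV_along_line f)
  qed (use h in auto)
  then obtain s where s: "0 < s" "s < h" and \<phi>: "\<phi> h - \<phi> 0 = h *
      (partial_deriv a f ((x + h *\<^sub>R b) + s *\<^sub>R a) - partial_deriv a f (x + s *\<^sub>R a))"
    by auto
  have "\<exists>t. 0 < t \<and> t < h \<and>
      partial_deriv a f ((x + s *\<^sub>R a) + h *\<^sub>R b) - partial_deriv a f ((x + s *\<^sub>R a) + 0 *\<^sub>R b) =
      (h - 0) * partial_deriv b (partial_deriv a f) ((x + s *\<^sub>R a) + t *\<^sub>R b)"
    by (rule MVT2) (use h s ball in \<open>auto intro!: DERIV_along_line fa\<close>)
  then obtain t where t: "0 < t" "t < h"
    and "partial_deriv a f ((x + s *\<^sub>R a) + h *\<^sub>R b) - partial_deriv a f (x + s *\<^sub>R a) =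
      h * partial_deriv b (partial_deriv a f) (x + s *\<^sub>R a + t *\<^sub>R b)"
    by auto
  with \<phi> have "\<phi> h - \<phi> 0 = h\<^sup>2 * partial_deriv b (partial_deriv a f) (x + s *\<^sub>R a + t *\<^sub>R b)"
    by (simp add: power2_eq_square algebra_simps)
  moreover have "x + s *\<^sub>R a + t *\<^sub>R b \<in> ball x r"
    using ball s t by simp
  ultimately show ?thesis
    by (intro bexI[of _ "x + s *\<^sub>R a + t *\<^sub>R b"]) (simp_all add: \<phi>_def algebra_simps)
qed

text \<open>Schwarz's theorem. By the symmetry of the second difference, the two mixed derivatives
  agree at two points arbitrarily near \<open>x\<close>, and continuity carries this over to
  \<open>x\<close>.\<close>

lemma partial_deriv_commute:
  assumes S: "open S" "x \<in> S" and f: "f differentiable_on S"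
    and fa: "partial_deriv a f differentiable_on S"
    and fb: "partial_deriv b f differentiable_on S"
    and ab: "continuous_on S (partial_deriv b (partial_deriv a f))"
    and ba: "continuous_on S (partial_deriv a (partial_deriv b f))"
  shows "partial_deriv a (partial_deriv b f) x = partial_deriv b (partial_deriv a f) x"
proof (rule ccontr)
  let ?P = "partial_deriv b (partial_deriv a f)" and ?Q = "partial_deriv a (partial_deriv b f)"
  assume "?Q x \<noteq> ?P x"
  \<comment> \<open>Half the gap: a value within \<open>e\<close> of \<open>?P x\<close> cannot
    equal a value within \<open>e\<close> of \<open>?Q x\<close>.\<close>
  define e where "e = \<bar>?Q x - ?P x\<bar> / 2"
  have "e > 0"
    using \<open>?Q x \<noteq> ?P x\<close> by (simp add: e_def)
  have "isCont ?P x" "isCont ?Q x"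
    using S ab ba by (simp_all add: continuous_on_eq_continuous_at)
  then have "\<forall>\<^sub>F y in nhds x. y \<in> S \<and> dist (?P y) (?P x) < e \<and> dist (?Q y) (?Q x) < e"
    using S \<open>e > 0\<close> by (auto simp: continuous_at tendsto_at_iff_tendsto_nhds intro!: eventually_conj
        eventually_nhds_in_open tendstoD)
  then obtain r where r: "r > 0"
    and near: "\<And>y. y \<in> ball x r \<Longrightarrow> y \<in> S \<and> dist (?P y) (?P x) < e \<and> dist (?Q y) (?Q x) < e"
    by (auto simp: eventually_nhds_metric dist_commute)
  have diff: "g differentiable at y" if "g differentiable_on S" "y \<in> ball x r" for g :: "'a \<Rightarrow> real" and y
    using that S near by (metis at_within_open differentiable_on_def)
  \<comment> \<open>The summand \<open>1\<close> keeps the denominator positive even if both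
    directions are zero.\<close>
  define h where "h = r / (2 * (norm a + norm b + 1))"
  have "norm a + norm b + 1 > 0"
    by (smt (verit) norm_ge_zero)
  then have h: "0 < h" "h * (norm a + norm b) < r"
    using r by (auto simp: h_def field_simps intro!: add_nonneg_pos)
  obtain p where p: "p \<in> ball x r"
    "f (x + h *\<^sub>R a + h *\<^sub>R b) - f (x + h *\<^sub>R a) - f (x + h *\<^sub>R b) + f x = h\<^sup>2 * ?P p"
    using second_difference_mean_value[of x r f a h b] diff f fa h by blast
  \<comment> \<open>The same second difference, with the roles of \<open>a\<close> and
    \<open>b\<close> exchanged.\<close>
  obtain q where q: "q \<in> ball x r"
    "f (x + h *\<^sub>R b + h *\<^sub>R a) - f (x + h *\<^sub>R b) - f (x + h *\<^sub>R a) + f x = h\<^sup>2 * ?Q q"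
    using second_difference_mean_value[of x r f b h a] diff f fb h by (metis add.commute)
  have "h\<^sup>2 * ?P p = h\<^sup>2 * ?Q q"
    unfolding p(2)[symmetric] q(2)[symmetric] by (simp add: algebra_simps)
  then have "?P p = ?Q q"
    using h by simp
  moreover have "dist (?P p) (?P x) < e" "dist (?Q q) (?Q x) < e"
    using near p(1) q(1) by auto
  ultimately show False
    unfolding e_def dist_real_def by (smt (verit) field_sum_of_halves)
qed

lemma Ck_on_2_partial_deriv_commute:
  assumes "Ck_on 2 S f" "open S" "x \<in> S" "a \<in> Basis" "b \<in> Basis"
  shows "partial_deriv a (partial_deriv b f) x = partial_deriv b (partial_deriv a f) x"
  by (rule partial_deriv_commute[of S]) (use assms in \<open>auto simp: numeral_2_eq_2\<close>)

text \<open>The total derivative is linear and vanishes on the standard basis, hence is zero; on a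
  convex set this forces constancy.\<close>

lemma gradient_zero_imp_constant:
  fixes u :: "real ^ 'n \<Rightarrow> real"
  assumes u: "u differentiable_on S" and S: "open S" "convex S"
    and grad: "\<And>x. x \<in> S \<Longrightarrow> gradient u x = 0"
  shows "\<exists>c. \<forall>x\<in>S. u x = c"
proof (rule has_derivative_zero_constant[OF \<open>convex S\<close>])
  fix x assume "x \<in> S"
  then obtain D where D: "(u has_derivative D) (at x)"
    using u S by (metis at_within_open differentiable_def differentiable_on_def)
  have "D = (\<lambda>_. 0)"
  proof (rule linear_eq_stdbasis)
    fix b :: "real ^ 'n" assume "b \<in> Basis"
    then obtain i where "b = axis i 1"
      by (auto simp: Basis_vec_def)
    then have "D b = gradient u x $ i"
      using has_derivative_partial_deriv[OF D] by (simp add: gradient_def)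
    then show "D b = 0"
      using grad[OF \<open>x \<in> S\<close>] by simp
  qed (use D in \<open>auto intro: has_derivative_linear linear_zero\<close>)
  with D show "(u has_derivative (\<lambda>_. 0)) (at x within S)"
    using has_derivative_at_withinI by blast
qed

theorem corollary4:
  fixes \<Omega> :: "(real ^ 'n) set"
    and L :: "(real ^ 'n) \<times> real \<times> (real ^ 'n) \<Rightarrow> real"
    and u :: "real ^ 'n \<Rightarrow> real"
  assumes "open \<Omega>" and "connected \<Omega>" and "bounded \<Omega>"
    and "Ck_on 2 (\<Omega> \<times> UNIV \<times> UNIV) L"
    and "C1_closure_on (\<Omega> \<times> UNIV \<times> UNIV) L"
    and "\<And>x s. x \<in> \<Omega> \<Longrightarrow> (\<Sum>i\<in>UNIV. deriv_z i (deriv_x i L) (x, s, 0)) = 0"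
    and "\<And>x s i. x \<in> \<Omega> \<Longrightarrow> deriv_u (deriv_x i L) (x, s, 0) = 0"
    and "\<And>x s z. x \<in> \<Omega> \<Longrightarrow> deriv_u L (x, s, z) \<noteq> 0"
    and "Ck_on 2 \<Omega> u"
    and "C1_closure_on \<Omega> u"
    and "\<And>x. x \<in> \<Omega> \<Longrightarrow>
      (\<Sum>j\<in>UNIV. partial_deriv (axis j 1) (\<lambda>y. deriv_z j L (y, u y, gradient u y)) x)
        - deriv_u L (x, u x, gradient u x) = 0"
  shows "interior {x \<in> \<Omega>. gradient u x = 0} = {}"
proof (rule ccontr)
  assume "interior {x \<in> \<Omega>. gradient u x = 0} \<noteq> {}"
  then obtain x r where r: "r > 0" and B: "ball x r \<subseteq> {x \<in> \<Omega>. gradient u x = 0}"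
    by (auto simp: mem_interior)
  then have x: "x \<in> ball x r" "x \<in> \<Omega>"
    using centre_in_ball[of x r] by blast+
  have "u differentiable_on ball x r"
    using assms(9) B by (auto simp: numeral_2_eq_2 intro: differentiable_on_subset)
  then obtain c where c: "\<And>y. y \<in> ball x r \<Longrightarrow> u y = c"
    using gradient_zero_imp_constant[of u "ball x r"] B by blast
  have "partial_deriv (axis j 1) (\<lambda>y. deriv_z j L (y, u y, gradient u y)) x =
      deriv_z j (deriv_x j L) (x, c, 0)" for j :: 'n
  proof -
    \<comment> \<open>\<open>deriv\<close> at \<open>0\<close> depends only on values near
      \<open>0\<close>. There the line stays in the ball, where \<open>u\<close> is \<open>c\<close>
      and the gradient is zero, so only the \<open>x\<close> slot of \<open>deriv_z j L\<close>
      varies.\<close>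
    have "((\<lambda>t. x + t *\<^sub>R axis j 1) \<longlongrightarrow> x + 0 *\<^sub>R axis j 1) (nhds (0 :: real))"
      by (intro tendsto_intros filterlim_ident)
    then have "\<forall>\<^sub>F t in nhds 0. x + t *\<^sub>R axis j 1 \<in> ball x r"
      by (rule topological_tendstoD) (use x in auto)
    then have "\<forall>\<^sub>F t in nhds 0. deriv_z j L (x + t *\<^sub>R axis j 1, u (x + t *\<^sub>R axis j 1),
        gradient u (x + t *\<^sub>R axis j 1)) = deriv_z j L ((x, c, 0) + t *\<^sub>R (axis j 1, 0, 0))"
      by eventually_elim (use c B in auto)
    then have "partial_deriv (axis j 1) (\<lambda>y. deriv_z j L (y, u y, gradient u y)) x =
        deriv_x j (deriv_z j L) (x, c, 0)"
      unfolding partial_deriv_def deriv_x_def by (intro deriv_cong_ev refl)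
    \<comment> \<open>The equation differentiates in \<open>z\<close> first, the hypothesis in
      \<open>x\<close> first; both directions are basis vectors of the product space, so Schwarz's
      theorem applies.\<close>
    also have "\<dots> = deriv_z j (deriv_x j L) (x, c, 0)"
      unfolding deriv_x_def deriv_z_def
      by (rule Ck_on_2_partial_deriv_commute[OF assms(4)])
        (use assms(1) x in \<open>auto simp: Basis_prod_def image_iff zero_prod_def intro!: open_Times\<close>)
    finally show ?thesis .
  qed
  \<comment> \<open>The sum in the equation is now the one assumed to vanish, which leaves
    \<open>deriv_u L (x, c, 0) = 0\<close>.\<close>
  then show False
    using assms(6)[of x c] assms(8)[of x "u x" "gradient u x"] assms(11)[of x] x by simp
qed

end
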